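(* Let $0<\lambda_2<\lambda_1<1$ and for $c>0$ let $$A_c=\begin{pmatrix}\lambda_1&c\\0&\lambda_2\end{pmatrix},$$ and let $\Sigma_c$ be the solution of the discrete Lyapunov equation $\Sigma_c=A_c\Sigma_cA_c^*+I$ (i.e. $B G_uB^*=I$). Then, as $c\to\infty$: $\kappa_2(V_c)=\Theta(c)$; both Koopman modes (the unit right eigenvectors of $A_c$) converge to $e_1$ (up to sign); and the minor principal direction of $\Sigma_c$ (its unit eigenvector for the smallest eigenvalue) converges to $e_2$ (up to sign). Consequently the angle $\theta$ between that minor principal direction and the nearest Koopman mode tends to $\pi/2$, with $|\cos\theta|=O(\kappa_2(V_c)^{-1})$.
   Context: $V_c$ is the matrix of unit-norm right eigenvectors of $A_c$; $\kappa_2(V)=\|V\|_2\|V^{-1}\|_2$; $e_1,e_2$ are the standard basis vectors of $\mathbb R^2$. Asymptotic notation is for $c\to\infty$ with $\lambda_1,\lambda_2$ fixed. *)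

theory Defs
  imports "HOL-Analysis.Analysis" "HOL-Library.Landau_Symbols"
begin

definition eigenpair :: "real^'n^'n \<Rightarrow> real \<Rightarrow> real^'n \<Rightarrow> bool" where
  "eigenpair A \<mu> v \<longleftrightarrow> v \<noteq> 0 \<and> A *v v = \<mu> *\<^sub>R v"

(* Such a V is unique only up to the order and the signs of its columns. *)
definition unit_eigenvector_matrix :: "real^'n^'n \<Rightarrow> real^'n^'n \<Rightarrow> bool" where
  "unit_eigenvector_matrix A V \<longleftrightarrow>
     invertible V \<and> (\<forall>j. norm (column j V) = 1 \<and> (\<exists>\<mu>. eigenpair A \<mu> (column j V)))"

definition cond2 :: "real^'n^'n \<Rightarrow> real" where
  "cond2 V = onorm ((*v) V) * onorm ((*v) (matrix_inv V))"

definition lyapunov_solution :: "real^'n^'n \<Rightarrow> real^'n^'n \<Rightarrow> real^'n^'n \<Rightarrow> bool" where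
  "lyapunov_solution A Q S \<longleftrightarrow> S = A ** S ** transpose A + Q"

definition minor_principal_direction :: "real^'n^'n \<Rightarrow> real^'n \<Rightarrow> bool" where
  "minor_principal_direction S u \<longleftrightarrow>
     norm u = 1 \<and> (\<exists>\<mu>. eigenpair S \<mu> u \<and> (\<forall>\<nu> w. eigenpair S \<nu> w \<longrightarrow> \<mu> \<le> \<nu>))"

(* The sign may vary with the parameter. *)
definition tendsto_up_to_sign ::
    "('a \<Rightarrow> 'b::real_normed_vector) \<Rightarrow> 'b \<Rightarrow> 'a filter \<Rightarrow> bool" where
  "tendsto_up_to_sign f l F \<longleftrightarrow>
     (\<exists>s :: 'a \<Rightarrow> real. (\<forall>x. s x = 1 \<or> s x = -1) \<and> ((\<lambda>x. s x *\<^sub>R f x) \<longlongrightarrow> l) F)"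

(* Angle in [0, pi/2] between the lines spanned by x and y: eigenvectors are determined
   only up to sign, so the orientation of x and y must not matter. *)
definition line_angle :: "'a::real_inner \<Rightarrow> 'a \<Rightarrow> real" where
  "line_angle x y = arccos (\<bar>x \<bullet> y\<bar> / (norm x * norm y))"

definition nearest_mode_angle :: "real^'n \<Rightarrow> real^'n^'n \<Rightarrow> real" where
  "nearest_mode_angle u V = Min (range (\<lambda>j. line_angle u (column j V)))"

definition shear_matrix :: "real \<Rightarrow> real \<Rightarrow> real \<Rightarrow> real^2^2" where
  "shear_matrix l1 l2 c = vector [vector [l1, c], vector [0, l2]]"

definition shear_covariance :: "real \<Rightarrow> real \<Rightarrow> real \<Rightarrow> real^2^2" where
  "shear_covariance l1 l2 c = (THE S. lyapunov_solution (shear_matrix l1 l2 c) (mat 1) S)"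

end

theory Submission
  imports Defs
begin

text \<open>With \<open>d = \<lambda>\<^sub>1 - \<lambda>\<^sub>2\<close>, the unit eigenvectors of \<open>A\<^sub>c\<close> are, up to sign, \<open>e\<^sub>1\<close> and
  \<open>(c, -d) / N\<close> with \<open>N = sqrt (c\<^sup>2 + d\<^sup>2)\<close>, so \<open>\<bar>det V\<^sub>c\<bar> = d / N\<close>, and for a 2 by 2 matrix with
  unit columns the condition number is comparable to \<open>1 / \<bar>det V\<bar>\<close>.  Solving the Lyapunov equation
  entrywise shows that the (1,1), (1,2) and (2,2) entries of \<open>\<Sigma>\<^sub>c\<close> have orders \<open>c\<^sup>2\<close>, \<open>c\<close> and 1.
  The smallest eigenvalue is at most the (2,2) entry, so the first row of the eigenvector equation
  bounds the first component of the minor direction by \<open>O(1/c)\<close>.  The second components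
  of the modes are \<open>O(1/c)\<close> too, and hence so are all inner products between them and the minor
  direction.\<close>

section \<open>Vectors and eigenpairs in the plane\<close>

lemma norm_vec2_power2: "(norm (v :: real^2))\<^sup>2 = (v$1)\<^sup>2 + (v$2)\<^sup>2"
  unfolding power2_norm_eq_inner by (simp add: inner_vec_def sum_2 power2_eq_square)

lemma norm_vec2_eq_1_iff: "norm (v :: real^2) = 1 \<longleftrightarrow> (v$1)\<^sup>2 + (v$2)\<^sup>2 = 1"
  unfolding norm_vec2_power2[symmetric] by (simp add: power2_eq_1_iff) (metis norm_ge_zero not_one_le_zero
      neg_0_le_iff_le)

lemma eigenpair_vector2_iff:
  "eigenpair (vector [vector [p, q], vector [r, s]] :: real^2^2) \<mu> v \<longleftrightarrow>
     v \<noteq> 0 \<and> p * v$1 + q * v$2 = \<mu> * v$1 \<and> r * v$1 + s * v$2 = \<mu> * v$2"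
  by (simp add: eigenpair_def vec_eq_iff forall_2 matrix_vector_mult_def sum_2)

section \<open>Convergence up to sign\<close>

text \<open>If the sign makes the inner product with \<open>e\<close> nonnegative, the squared
  distance of the two unit vectors is \<open>2 - 2 * \<bar>f x \<bullet> e\<bar>\<close>, which
  tends to 0.\<close>

lemma tendsto_up_to_signI:
  fixes f :: "'a \<Rightarrow> 'b::real_inner"
  assumes "norm e = 1" and "\<forall>\<^sub>F x in F. norm (f x) = 1"
    and "((\<lambda>x. \<bar>f x \<bullet> e\<bar>) \<longlongrightarrow> 1) F"
  shows "tendsto_up_to_sign f e F"
proof -
  define s where "s x = (if f x \<bullet> e \<ge> 0 then 1 else -1 :: real)" for x
  have dist_eq: "norm (s x *\<^sub>R f x - e) = sqrt (2 - 2 * \<bar>f x \<bullet> e\<bar>)" if "norm (f x) = 1" for x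
  proof -
    have "f x \<bullet> f x = 1" "e \<bullet> e = 1"
      using that assms(1) by (simp_all add: norm_eq_1)
    then have "(s x *\<^sub>R f x - e) \<bullet> (s x *\<^sub>R f x - e) = 2 - 2 * \<bar>f x \<bullet> e\<bar>"
      by (simp add: s_def inner_diff_left inner_diff_right inner_add_left inner_add_right inner_commute)
    then show ?thesis by (simp add: norm_eq_sqrt_inner)
  qed
  have "((\<lambda>x. sqrt (2 - 2 * \<bar>f x \<bullet> e\<bar>)) \<longlongrightarrow> sqrt (2 - 2 * 1)) F"
    by (intro tendsto_intros assms)
  then have "((\<lambda>x. norm (s x *\<^sub>R f x - e)) \<longlongrightarrow> 0) F"
    using assms(2) by (subst tendsto_cong[where g = "\<lambda>x. sqrt (2 - 2 * \<bar>f x \<bullet> e\<bar>)"])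
      (auto elim!: eventually_mono simp: dist_eq)
  then have "((\<lambda>x. s x *\<^sub>R f x) \<longlongrightarrow> e) F"
    by (simp add: tendsto_norm_zero_iff LIM_zero_iff)
  then show ?thesis
    unfolding tendsto_up_to_sign_def by (intro exI[of _ s]) (auto simp: s_def)
qed

text \<open>A unit vector in the plane has
  \<open>\<bar>f c $ i\<bar> = sqrt (1 - (f c $ j)\<^sup>2)\<close>, so decay of one component
  settles the other. The indices stay general to serve both limits, \<open>e\<^sub>1\<close> for the
  modes and \<open>e\<^sub>2\<close> for the minor direction.\<close>

lemma tendsto_up_to_sign_axis2:
  fixes f :: "real \<Rightarrow> real^2"
  assumes ij: "{i, j} = (UNIV :: 2 set)" and le: "\<forall>\<^sub>F c in at_top. norm (f c) = 1 \<and> \<bar>f c $ j\<bar> \<le> K / c"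
  shows "tendsto_up_to_sign f (axis i 1) at_top"
proof (rule tendsto_up_to_signI)
  have "((\<lambda>c. K / c) \<longlongrightarrow> 0) at_top"
    by (intro tendsto_divide_0[OF tendsto_const] filterlim_at_top_imp_at_infinity filterlim_ident)
  then have "((\<lambda>c. f c $ j) \<longlongrightarrow> 0) at_top"
    by (rule Lim_null_comparison[rotated]) (use le in \<open>auto elim: eventually_mono\<close>)
  then have "((\<lambda>c. sqrt (1 - (f c $ j)\<^sup>2)) \<longlongrightarrow> sqrt (1 - 0\<^sup>2)) at_top"
    by (intro tendsto_intros)
  moreover have "\<forall>\<^sub>F c in at_top. sqrt (1 - (f c $ j)\<^sup>2) = \<bar>f c \<bullet> axis i 1\<bar>"
    using le
  proof (rule eventually_mono)
    fix c assume "norm (f c) = 1 \<and> \<bar>f c $ j\<bar> \<le> K / c"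
    then have "(f c $ i)\<^sup>2 + (f c $ j)\<^sup>2 = 1"
      using ij exhaust_2[of i] exhaust_2[of j]
      by (auto simp: norm_vec2_eq_1_iff UNIV_2 add.commute)
    then have "1 - (f c $ j)\<^sup>2 = (f c $ i)\<^sup>2" by simp
    then show "sqrt (1 - (f c $ j)\<^sup>2) = \<bar>f c \<bullet> axis i 1\<bar>"
      by (simp add: inner_axis)
  qed
  ultimately show "((\<lambda>c. \<bar>f c \<bullet> axis i 1\<bar>) \<longlongrightarrow> 1) at_top"
    by (simp add: tendsto_cong)
qed (use le in \<open>auto elim: eventually_mono simp: norm_axis_1\<close>)

section \<open>Minor direction of a symmetric 2 by 2 matrix\<close>

text \<open>The smaller root of the characteristic polynomial of the symmetric matrix with rows
  \<open>(x, y)\<close> and \<open>(y, z)\<close>.\<close>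

definition small_eigenvalue :: "real \<Rightarrow> real \<Rightarrow> real \<Rightarrow> real" where
  "small_eigenvalue x y z = ((x + z) - sqrt ((x - z)\<^sup>2 + 4 * y\<^sup>2)) / 2"

lemma small_eigenvalue_root: "(x - small_eigenvalue x y z) * (z - small_eigenvalue x y z) = y\<^sup>2"
proof -
  define r where "r = sqrt ((x - z)\<^sup>2 + 4 * y\<^sup>2)"
  have r2: "r * r = (x - z)\<^sup>2 + 4 * y\<^sup>2" by (simp add: r_def)
  \<comment> \<open>The two factors are \<open>(r + (x - z)) / 2\<close> and
    \<open>(r - (x - z)) / 2\<close>.\<close>
  have "(x - small_eigenvalue x y z) * (z - small_eigenvalue x y z) = (r * r - (x - z)\<^sup>2) / 4"
    unfolding small_eigenvalue_def r_def[symmetric] by (simp add: power2_eq_square field_simps)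
  also have "\<dots> = y\<^sup>2" unfolding r2 by simp
  finally show ?thesis .
qed

lemma small_eigenvalue_le_diag: "small_eigenvalue x y z \<le> z"
proof -
  have "sqrt ((x - z)\<^sup>2) \<le> sqrt ((x - z)\<^sup>2 + 4 * y\<^sup>2)" by (intro real_sqrt_le_mono) simp
  then show ?thesis by (simp add: small_eigenvalue_def)
qed

lemma small_eigenvalue_least:
  assumes "(x - \<nu>) * (z - \<nu>) = y\<^sup>2"
  shows "small_eigenvalue x y z \<le> \<nu>"
proof -
  have "(x + z - 2 * \<nu>)\<^sup>2 = (x - z)\<^sup>2 + 4 * y\<^sup>2"
    using assms[symmetric] by (simp add: power2_eq_square algebra_simps)
  then have "sqrt ((x - z)\<^sup>2 + 4 * y\<^sup>2) = \<bar>x + z - 2 * \<nu>\<bar>"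
    by (metis real_sqrt_abs)
  then show ?thesis by (simp add: small_eigenvalue_def)
qed

text \<open>The determinant of \<open>S - m\<close> vanishes and \<open>y\<close> is nonzero, so the
  second row of the eigenvector equation follows from the first.\<close>

lemma minor_principal_direction_sym2_iff:
  fixes S :: "real^2^2"
  assumes S: "S = vector [vector [x, y], vector [y, z]]" and "y \<noteq> 0"
  defines "m \<equiv> small_eigenvalue x y z"
  shows "minor_principal_direction S w \<longleftrightarrow> norm w = 1 \<and> (m - x) * w$1 = y * w$2"
proof -
  have root: "(x - m) * (z - m) = y\<^sup>2"
    unfolding m_def by (rule small_eigenvalue_root)
  have eig_m: "eigenpair S m v \<longleftrightarrow> v \<noteq> 0 \<and> (m - x) * v$1 = y * v$2" for v
  proof -
    have "y * v$1 + z * v$2 = m * v$2" if *: "(m - x) * v$1 = y * v$2"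
    proof -
      \<comment> \<open>After multiplication by \<open>y\<close>, the first row eliminates
        \<open>v$2\<close> and \<open>root\<close> cancels the rest.\<close>
      have "y * (y * v$1 + (z - m) * v$2) = y\<^sup>2 * v$1 + (z - m) * (y * v$2)"
        by (simp add: algebra_simps power2_eq_square)
      also have "\<dots> = 0" unfolding *[symmetric] root[symmetric] by (simp add: algebra_simps)
      finally have "y * v$1 + (z - m) * v$2 = 0" using \<open>y \<noteq> 0\<close> by simp
      then show ?thesis by (simp add: algebra_simps)
    qed
    then show ?thesis by (auto simp: S eigenpair_vector2_iff algebra_simps)
  qed
  have least: "m \<le> \<nu>" if "eigenpair S \<nu> v" for \<nu> v
  proof -
    have e: "(x - \<nu>) * v$1 = - (y * v$2)" "(z - \<nu>) * v$2 = - (y * v$1)" "v \<noteq> 0"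
      using that by (auto simp: S eigenpair_vector2_iff algebra_simps)
    \<comment> \<open>Using both rows in turn shows that the characteristic polynomial at
      \<open>\<nu>\<close> annihilates \<open>v$1\<close>; if \<open>v$1\<close> were 0, the first
      row would force \<open>v = 0\<close>.\<close>
    have "((x - \<nu>) * (z - \<nu>) - y\<^sup>2) * v$1 = (z - \<nu>) * ((x - \<nu>) * v$1) - y\<^sup>2 * v$1"
      by (simp add: algebra_simps)
    also have "\<dots> = - (y * ((z - \<nu>) * v$2)) - y\<^sup>2 * v$1"
      unfolding e(1) by (simp add: algebra_simps)
    finally have "((x - \<nu>) * (z - \<nu>) - y\<^sup>2) * v$1 = 0"
      unfolding e(2) by (simp add: algebra_simps power2_eq_square)
    moreover have "v$1 \<noteq> 0"
      using e \<open>y \<noteq> 0\<close> by (auto simp: vec_eq_iff forall_2)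
    ultimately show ?thesis
      unfolding m_def by (intro small_eigenvalue_least) simp
  qed
  \<comment> \<open>So \<open>m\<close> is attained as an eigenvalue, and with \<open>least\<close>
    it is the only possible minimum.\<close>
  have "eigenpair S m (vector [y, m - x])"
    using \<open>y \<noteq> 0\<close> by (simp add: eig_m vec_eq_iff forall_2)
  then have "minor_principal_direction S w \<longleftrightarrow> norm w = 1 \<and> eigenpair S m w"
    unfolding minor_principal_direction_def using least by (metis order_antisym)
  then show ?thesis by (auto simp: eig_m)
qed

text \<open>The solutions of the linear condition form the line spanned by
  \<open>(y, m - x)\<close>, which meets the unit circle in two opposite points.\<close>

lemma minor_principal_direction_sym2_unique:
  fixes S :: "real^2^2"
  assumes S: "S = vector [vector [x, y], vector [y, z]]" and "y \<noteq> 0"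
  shows "\<exists>u. {w. minor_principal_direction S w} = {u, - u}"
proof -
  define m where "m = small_eigenvalue x y z"
  define p :: "real^2" where "p = vector [y, m - x]"
  define u where "u = p /\<^sub>R norm p"
  have iff: "minor_principal_direction S w \<longleftrightarrow> norm w = 1 \<and> (m - x) * w$1 = y * w$2" for w
    unfolding m_def by (rule minor_principal_direction_sym2_iff[OF assms])
  have "p \<noteq> 0" using \<open>y \<noteq> 0\<close> by (auto simp: p_def vec_eq_iff forall_2)
  then have "minor_principal_direction S u"
    by (simp add: iff u_def) (simp add: p_def)
  then have "minor_principal_direction S (- u)"
    by (simp add: iff)
  moreover have "w = u \<or> w = - u" if "minor_principal_direction S w" for w
  proof -
    have w: "norm w = 1" "(m - x) * w$1 = y * w$2" using that by (auto simp: iff)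
    define t where "t = w$1 / y"
    have wt: "w = t *\<^sub>R p"
      using w(2) \<open>y \<noteq> 0\<close> by (simp add: vec_eq_iff forall_2 p_def t_def field_simps)
    then have "\<bar>t\<bar> * norm p = 1" using w(1) by simp
    then have "t = inverse (norm p) \<or> t = - inverse (norm p)"
      using \<open>p \<noteq> 0\<close> by (auto simp: field_simps abs_if split: if_splits)
    then show ?thesis unfolding u_def using wt by auto
  qed
  ultimately show ?thesis using \<open>minor_principal_direction S u\<close> by (intro exI[of _ u]) auto
qed

lemma minor_principal_direction_sym2_bound:
  fixes S :: "real^2^2"
  assumes S: "S = vector [vector [x, y], vector [y, z]]" and "y \<noteq> 0"
    and "minor_principal_direction S u"
  shows "(x - z) * \<bar>u$1\<bar> \<le> \<bar>y\<bar>"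
proof -
  define m where "m = small_eigenvalue x y z"
  have u: "norm u = 1" "(m - x) * u$1 = y * u$2"
    using minor_principal_direction_sym2_iff[OF assms(1,2)] assms(3) by (auto simp: m_def)
  \<comment> \<open>Passing to the absolute value avoids a separate proof of
    \<open>m \<le> x\<close>.\<close>
  have "(x - m) * \<bar>u$1\<bar> \<le> \<bar>x - m\<bar> * \<bar>u$1\<bar>"
    by (intro mult_right_mono) auto
  also have "\<dots> = \<bar>(m - x) * u$1\<bar>" by (simp add: abs_mult abs_minus_commute)
  finally have abs_ge: "(x - m) * \<bar>u$1\<bar> \<le> \<bar>(m - x) * u$1\<bar>" .
  have "(x - z) * \<bar>u$1\<bar> \<le> (x - m) * \<bar>u$1\<bar>"
    using small_eigenvalue_le_diag[of x y z] by (intro mult_right_mono) (auto simp: m_def)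
  also have "\<dots> \<le> \<bar>(m - x) * u$1\<bar>"
    by (fact abs_ge)
  also have "\<dots> = \<bar>y\<bar> * \<bar>u$2\<bar>" by (simp add: u(2) abs_mult)
  also have "\<dots> \<le> \<bar>y\<bar> * 1"
    using component_le_norm_cart[of u 2] u(1) by (intro mult_left_mono) auto
  finally show ?thesis by simp
qed

section \<open>Entrywise solution of the Lyapunov equation\<close>

definition cov22 :: "real \<Rightarrow> real" where
  "cov22 b = 1 / (1 - b\<^sup>2)"

definition cov12 :: "real \<Rightarrow> real \<Rightarrow> real \<Rightarrow> real" where
  "cov12 a b c = b * c * cov22 b / (1 - a * b)"

definition cov11 :: "real \<Rightarrow> real \<Rightarrow> real \<Rightarrow> real" where
  "cov11 a b c = (1 + 2 * a * c * cov12 a b c + c\<^sup>2 * cov22 b) / (1 - a\<^sup>2)"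

text \<open>Entrywise the equation is a triangular linear system: first the (2,2) entry, then the
  off-diagonal ones, then (1,1). Both off-diagonal entries satisfy the same scalar equation, so
  symmetry is a conclusion. The equivalence gives existence and uniqueness at once.\<close>

lemma lyapunov_solution_shear_iff:
  assumes "a\<^sup>2 \<noteq> 1" and "b\<^sup>2 \<noteq> 1" and "a * b \<noteq> 1"
  shows "lyapunov_solution (shear_matrix a b c) (mat 1) S \<longleftrightarrow>
    S = vector [vector [cov11 a b c, cov12 a b c], vector [cov12 a b c, cov22 b]]"
proof -
  define x y y' z where "x = S$1$1" and "y = S$1$2" and "y' = S$2$1" and "z = S$2$2"
  note defs = x_def y_def y'_def z_def
  have "lyapunov_solution (shear_matrix a b c) (mat 1) S \<longleftrightarrow>
      x = a\<^sup>2 * x + a * c * (y + y') + c\<^sup>2 * z + 1 \<and> y = a * b * y + b * c * z \<and>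
      y' = a * b * y' + b * c * z \<and> z = b\<^sup>2 * z + 1"
    unfolding defs
    by (simp add: lyapunov_solution_def shear_matrix_def vec_eq_iff forall_2 matrix_matrix_mult_def
        sum_2 transpose_def mat_def algebra_simps power2_eq_square)
  also have "z = b\<^sup>2 * z + 1 \<longleftrightarrow> z = cov22 b"
    using assms by (auto simp: cov22_def field_simps)
  also have "y = a * b * y + b * c * z \<longleftrightarrow> y = b * c * z / (1 - a * b)"
    using assms by (auto simp: field_simps)
  also have "y' = a * b * y' + b * c * z \<longleftrightarrow> y' = b * c * z / (1 - a * b)"
    using assms by (auto simp: field_simps)
  also have "x = a\<^sup>2 * x + a * c * (y + y') + c\<^sup>2 * z + 1 \<longleftrightarrow>
      x = (1 + a * c * (y + y') + c\<^sup>2 * z) / (1 - a\<^sup>2)"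
    using assms by (auto simp: field_simps)
  finally show ?thesis
    by (auto simp: vec_eq_iff forall_2 defs cov11_def cov12_def algebra_simps)
qed

lemma shear_covariance_eq:
  assumes "a\<^sup>2 \<noteq> 1" and "b\<^sup>2 \<noteq> 1" and "a * b \<noteq> 1"
  shows "shear_covariance a b c =
    vector [vector [cov11 a b c, cov12 a b c], vector [cov12 a b c, cov22 b]]"
  unfolding shear_covariance_def lyapunov_solution_shear_iff[OF assms] by simp

section \<open>Eigenvectors of the shear matrix\<close>

text \<open>If \<open>v$2\<close> is nonzero, the second row forces the eigenvalue \<open>b\<close>,
  and the first row then makes \<open>v\<close> proportional to
  \<open>(c, -(a - b))\<close>.\<close>

lemma unit_eigenvector_shear_bound:
  assumes "norm v = 1" and "eigenpair (shear_matrix a b c) \<mu> v" and "b < a" and "c > 0"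
  shows "\<bar>v$2\<bar> \<le> (a - b) / c"
proof (cases "v$2 = 0")
  case False
  then have "(a - b) * v$1 = - (c * v$2)"
    using assms(2) by (auto simp: shear_matrix_def eigenpair_vector2_iff algebra_simps)
  then have "c * \<bar>v$2\<bar> = (a - b) * \<bar>v$1\<bar>"
    using assms(3,4) by (metis abs_minus abs_mult abs_of_pos diff_gt_0_iff_gt)
  also have "\<dots> \<le> (a - b) * 1"
    using component_le_norm_cart[of v 1] assms by (intro mult_left_mono) auto
  finally show ?thesis using assms by (simp add: field_simps)
qed (use assms in auto)

lemma ex_unit_eigenvector_matrix_shear:
  assumes "b < a" and "c > 0"
  shows "\<exists>V. unit_eigenvector_matrix (shear_matrix a b c) V"
proof -
  define N where "N = sqrt (c\<^sup>2 + (a - b)\<^sup>2)"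
  have pos: "c\<^sup>2 + (a - b)\<^sup>2 > 0" using assms by (intro add_pos_pos) auto
  then have "N > 0" by (simp add: N_def)
  have N2: "N\<^sup>2 = c\<^sup>2 + (a - b)\<^sup>2" using pos by (simp add: N_def)
  define V :: "real^2^2" where "V = vector [vector [1, c / N], vector [0, - ((a - b) / N)]]"
  have "det V \<noteq> 0" using \<open>N > 0\<close> assms by (simp add: V_def det_2)
  moreover have "norm (column 1 V) = 1" "norm (column 2 V) = 1"
    using \<open>N > 0\<close> N2
    by (simp_all add: norm_vec2_eq_1_iff column_def V_def power_divide add_divide_distrib[symmetric] pos[THEN less_imp_neq, symmetric] flip: N2)
  moreover have "eigenpair (shear_matrix a b c) a (column 1 V)"
    by (simp add: shear_matrix_def eigenpair_vector2_iff column_def V_def vec_eq_iff forall_2)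
  moreover have "eigenpair (shear_matrix a b c) b (column 2 V)"
    using \<open>N > 0\<close> assms
    by (simp add: shear_matrix_def eigenpair_vector2_iff column_def V_def vec_eq_iff forall_2 field_simps)
  ultimately show ?thesis
    unfolding unit_eigenvector_matrix_def invertible_det_nz forall_2 by blast
qed

text \<open>Each column lies on one of the two eigenlines, and invertibility forbids both from lying
  on the same one. The absolute value absorbs the order and the signs of the columns.\<close>

lemma det_unit_eigenvector_matrix_shear:
  assumes V: "unit_eigenvector_matrix (shear_matrix a b c) V" and "b < a" and "c > 0"
  shows "\<bar>det V\<bar> = (a - b) / sqrt (c\<^sup>2 + (a - b)\<^sup>2)"
proof -
  define d where "d = a - b"
  have "d > 0" using assms by (simp add: d_def)
  have pos: "c\<^sup>2 + d\<^sup>2 > 0" using \<open>d > 0\<close> assms by (intro add_pos_pos) auto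
  have type: "V$2$j = 0 \<or> d * V$1$j = - (c * V$2$j)" for j
    using V by (auto simp: unit_eigenvector_matrix_def shear_matrix_def eigenpair_vector2_iff
        column_def d_def algebra_simps)
  have unit: "(V$1$j)\<^sup>2 + (V$2$j)\<^sup>2 = 1" for j
    using V by (auto simp: unit_eigenvector_matrix_def norm_vec2_eq_1_iff column_def)
  have detV: "det V \<noteq> 0"
    using V by (simp add: unit_eigenvector_matrix_def invertible_det_nz)
  have *: "\<bar>V$1$i\<bar> * \<bar>V$2$j\<bar> = d / sqrt (c\<^sup>2 + d\<^sup>2)"
    if "V$2$i = 0" "d * V$1$j = - (c * V$2$j)" for i j
  proof -
    \<comment> \<open>The eigenline relation and the unit norm together determine
      \<open>\<bar>V$2$j\<bar>\<close>.\<close>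
    have "(c\<^sup>2 + d\<^sup>2) * (V$2$j)\<^sup>2 = (- (c * V$2$j))\<^sup>2 + d\<^sup>2 * (V$2$j)\<^sup>2"
      by (simp add: algebra_simps power_mult_distrib)
    also have "\<dots> = d\<^sup>2 * ((V$1$j)\<^sup>2 + (V$2$j)\<^sup>2)"
      unfolding that(2)[symmetric] by (simp add: algebra_simps power_mult_distrib)
    finally have "(V$2$j)\<^sup>2 = d\<^sup>2 / (c\<^sup>2 + d\<^sup>2)"
      using pos unfolding unit by (subst nonzero_eq_divide_eq) (use pos in \<open>auto simp: mult.commute\<close>)
    then have "\<bar>V$2$j\<bar> = d / sqrt (c\<^sup>2 + d\<^sup>2)"
      using \<open>d > 0\<close> by (metis real_sqrt_abs real_sqrt_divide abs_of_pos)
    moreover have "\<bar>V$1$i\<bar> = 1"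
      using unit[of i] that(1) by (simp add: power2_eq_1_iff abs_if split: if_splits) auto
    ultimately show ?thesis by simp
  qed
  consider "V$2$1 = 0" "V$2$2 = 0" | "V$2$1 = 0" "d * V$1$2 = - (c * V$2$2)"
    | "V$2$2 = 0" "d * V$1$1 = - (c * V$2$1)"
    | "d * V$1$1 = - (c * V$2$1)" "d * V$1$2 = - (c * V$2$2)"
    using type by blast
  then show ?thesis
  proof cases
    case 1
    then show ?thesis using detV by (simp add: det_2)
  next
    case 2
    then show ?thesis using *[of 1 2] by (simp add: det_2 abs_mult d_def)
  next
    case 3
    then show ?thesis using *[of 2 1] by (simp add: det_2 abs_mult d_def)
  next
    case 4
    \<comment> \<open>Both columns are on the line of eigenvalue \<open>b\<close>, so the
      determinant would vanish.\<close>
    have "d * det V = (d * V$1$1) * V$2$2 - (d * V$1$2) * V$2$1"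
      by (simp add: det_2 algebra_simps)
    also have "\<dots> = 0" unfolding 4 by simp
    finally show ?thesis using detV \<open>d > 0\<close> by simp
  qed
qed

section \<open>Condition number and determinant\<close>

lemma matrix_inv_eqI:
  fixes A :: "'a::semiring_1^'n^'m"
  assumes "A ** B = mat 1" and "B ** A = mat 1"
  shows "matrix_inv A = B"
proof -
  have "A ** matrix_inv A = mat 1 \<and> matrix_inv A ** A = mat 1"
    unfolding matrix_inv_def by (rule someI[of _ B]) (use assms in simp)
  then show ?thesis
    by (metis assms(2) matrix_mul_assoc matrix_mul_lid matrix_mul_rid)
qed

lemma matrix_inv_2:
  fixes V :: "real^2^2"
  assumes "det V \<noteq> 0"
  shows "matrix_inv V = vector [vector [V$2$2 / det V, - V$1$2 / det V],
                                vector [- V$2$1 / det V, V$1$1 / det V]]" (is "_ = ?W")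
proof -
  have "?W ** V = mat 1" "V ** ?W = mat 1"
    using assms by (simp_all add: vec_eq_iff forall_2 matrix_matrix_mult_def sum_2 mat_def
        add_divide_distrib[symmetric] diff_divide_distrib[symmetric]) (auto simp: det_2 field_simps)
  then show ?thesis by (rule matrix_inv_eqI[rotated])
qed

text \<open>The crude factor 4 counts the entries; only the order of growth matters later.\<close>

lemma onorm_matrix2_le:
  fixes M :: "real^2^2"
  assumes "\<And>i j. \<bar>M$i$j\<bar> \<le> B"
  shows "onorm ((*v) M) \<le> 4 * B"
  using onorm_le_matrix_component[of M B] assms by simp

text \<open>The inverse is the adjugate divided by the determinant, and the entries of the adjugate
  are those of \<open>V\<close> up to sign.  For the lower bound, the two rows of \<open>V\<close> have total squared
  norm 2, so one of the columns of the adjugate has norm at least 1.\<close>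

lemma cond2_unit_columns_bounds:
  fixes V :: "real^2^2"
  assumes unit: "\<And>j. norm (column j V) = 1" and det: "det V \<noteq> 0"
  shows "1 / \<bar>det V\<bar> \<le> cond2 V" and "cond2 V \<le> 16 / \<bar>det V\<bar>"
proof -
  define W where "W = matrix_inv V"
  note W = matrix_inv_2[OF det, folded W_def]
  have sq: "(V$1$j)\<^sup>2 + (V$2$j)\<^sup>2 = 1" for j
    using unit[of j] by (simp add: norm_vec2_eq_1_iff column_def)
  have entry: "\<bar>V$i$j\<bar> \<le> 1" for i j
    using component_le_norm_cart[of "column j V" i] unit[of j] by (simp add: column_def)
  have V_le: "onorm ((*v) V) \<le> 4"
    using onorm_matrix2_le[of V 1] entry by simp
  have "\<bar>W$i$j\<bar> \<le> 1 / \<bar>det V\<bar>" for i j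
    using exhaust_2[of i] exhaust_2[of j] entry
    by (auto simp: W abs_div divide_right_mono)
  then have W_le: "onorm ((*v) W) \<le> 4 / \<bar>det V\<bar>"
    using onorm_matrix2_le[of W "1 / \<bar>det V\<bar>"] by simp
  have col_le: "norm (column j M) \<le> onorm ((*v) M)" for j and M :: "real^2^2"
    using onorm[OF matrix_vector_mul_bounded_linear, of M "axis j 1"]
    by (simp add: matrix_vector_mult_basis norm_axis_1)
  have V_ge: "1 \<le> onorm ((*v) V)" using col_le[of 1 V] unit by simp
  have "(norm (column 1 W))\<^sup>2 + (norm (column 2 W))\<^sup>2 = 2 / (det V)\<^sup>2"
    using sq[of 1] sq[of 2]
    by (simp add: norm_vec2_power2 column_def W power_divide add_divide_distrib[symmetric])
  then have "(norm (column 1 W))\<^sup>2 \<ge> (1 / \<bar>det V\<bar>)\<^sup>2 \<or> (norm (column 2 W))\<^sup>2 \<ge> (1 / \<bar>det V\<bar>)\<^sup>2"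
    by (auto simp: power_divide)
  then have "norm (column 1 W) \<ge> 1 / \<bar>det V\<bar> \<or> norm (column 2 W) \<ge> 1 / \<bar>det V\<bar>"
    by (auto dest: power2_le_imp_le)
  then have W_ge: "onorm ((*v) W) \<ge> 1 / \<bar>det V\<bar>"
    using col_le[of _ W] order_trans by blast
  show "1 / \<bar>det V\<bar> \<le> cond2 V"
    using mult_mono[OF V_ge W_ge] V_ge by (simp add: cond2_def W_def)
  show "cond2 V \<le> 16 / \<bar>det V\<bar>"
    using mult_mono[OF V_le W_le] W_ge order_trans[OF _ W_ge, of 0] by (simp add: cond2_def W_def)
qed

section \<open>Angles between lines\<close>

text \<open>For a zero vector both sides are 0, because the quotient is 0 by convention and the
  angle is then \<open>pi / 2\<close>.\<close>

lemma cos_line_angle: "cos (line_angle x y) = \<bar>x \<bullet> y\<bar> / (norm x * norm y)"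
proof (cases "x = 0 \<or> y = 0")
  case False
  then have "\<bar>x \<bullet> y\<bar> / (norm x * norm y) \<le> 1"
    using Cauchy_Schwarz_ineq2[of x y] by (simp add: field_simps)
  then show ?thesis
    unfolding line_angle_def by (intro cos_arccos) (auto intro: order_trans[of _ 0])
qed (auto simp: line_angle_def)

lemma arccos_cos_line_angle: "arccos (cos (line_angle x y)) = line_angle x y"
  by (simp add: cos_line_angle) (simp add: line_angle_def)

text \<open>The minimum over finitely many columns is attained, so a bound valid for every mode
  applies to the nearest one.\<close>

lemma nearest_mode_angle_obtain:
  obtains j where "nearest_mode_angle u V = line_angle u (column j V)"
proof -
  have "nearest_mode_angle u V \<in> range (\<lambda>j. line_angle u (column j V))"
    unfolding nearest_mode_angle_def by (intro Min_in) auto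
  then show ?thesis using that by blast
qed

section \<open>Decay of the components and of the inner products\<close>

text \<open>The gap between the diagonal entries is at least \<open>c\<^sup>2 / 2 * cov22 b\<close>
  and the off-diagonal entry at most \<open>c / (1 - a * b) * cov22 b\<close>; the common factor
  cancels.\<close>

lemma minor_principal_direction_shear_bound:
  assumes ab: "0 < b" "b < a" "a < 1" and c: "c \<ge> 2"
    and u: "minor_principal_direction (shear_covariance a b c) u"
  shows "\<bar>u$1\<bar> \<le> 2 / (1 - a * b) / c"
proof -
  have lt1: "a\<^sup>2 < 1" "b\<^sup>2 < 1" "a * b < 1"
    using ab by (auto simp: power_less_one_iff) (smt (verit) mult_less_cancel_left2)
  have z: "cov22 b > 0" using lt1 by (simp add: cov22_def)
  have y: "cov12 a b c > 0" using z lt1 ab c by (simp add: cov12_def)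
  have "c\<^sup>2 * cov22 b \<le> 1 + 2 * a * c * cov12 a b c + c\<^sup>2 * cov22 b"
    using y ab c by simp
  also have "\<dots> \<le> cov11 a b c"
    \<comment> \<open>Dividing by \<open>1 - a\<^sup>2\<close>, which lies in (0, 1], can only
      enlarge the numerator.\<close>
    using y ab c z lt1 unfolding cov11_def
    by (intro divide_left_mono[where a = 1 and b = "1 - a\<^sup>2", simplified div_by_1]) auto
  finally have x: "c\<^sup>2 * cov22 b \<le> cov11 a b c" .
  have "c\<^sup>2 \<ge> 4" using power_mono[OF c, of 2] by simp
  then have "c\<^sup>2 / 2 * cov22 b \<le> (c\<^sup>2 - 1) * cov22 b"
    using z by (intro mult_right_mono) auto
  also have "\<dots> \<le> cov11 a b c - cov22 b" using x by (simp add: algebra_simps)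
  finally have "c\<^sup>2 / 2 * cov22 b * \<bar>u$1\<bar> \<le> (cov11 a b c - cov22 b) * \<bar>u$1\<bar>"
    by (rule mult_right_mono) simp
  also have "\<dots> \<le> cov12 a b c"
    using minor_principal_direction_sym2_bound[OF shear_covariance_eq _ u] lt1 y by simp
  also have "\<dots> \<le> c / (1 - a * b) * cov22 b"
    using ab z lt1 c by (simp add: cov12_def divide_right_mono)
  finally have "c\<^sup>2 / 2 * \<bar>u$1\<bar> \<le> c / (1 - a * b)"
    using z by (metis mult.assoc mult.commute mult_le_cancel_right_pos)
  then have "c * (c * \<bar>u$1\<bar>) \<le> c * (2 / (1 - a * b))"
    by (simp add: power2_eq_square field_simps)
  then have "c * \<bar>u$1\<bar> \<le> 2 / (1 - a * b)" using c by (subst (asm) mult_le_cancel_left_pos) auto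
  then show ?thesis using c by (subst pos_le_divide_eq) (simp_all add: mult.commute)
qed

text \<open>For \<open>u\<close> near \<open>e\<^sub>2\<close> and \<open>v\<close> near
  \<open>e\<^sub>1\<close>, each product in the inner product has one small factor.\<close>

lemma abs_inner_unit2_le:
  fixes u v :: "real^2"
  assumes "norm u = 1" and "norm v = 1"
  shows "\<bar>u \<bullet> v\<bar> \<le> \<bar>u$1\<bar> + \<bar>v$2\<bar>"
proof -
  have "\<bar>u \<bullet> v\<bar> \<le> \<bar>u$1\<bar> * \<bar>v$1\<bar> + \<bar>u$2\<bar> * \<bar>v$2\<bar>"
    by (simp add: inner_vec_def sum_2 flip: abs_mult)
  also have "\<dots> \<le> \<bar>u$1\<bar> * 1 + 1 * \<bar>v$2\<bar>"
    using component_le_norm_cart[of v 1] component_le_norm_cart[of u 2] assms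
    by (intro add_mono mult_left_mono mult_right_mono) auto
  finally show ?thesis by simp
qed

section \<open>Assembly of the asymptotic statements\<close>

theorem proposition8p2:
  fixes l1 l2 :: real
  assumes "0 < l2" and "l2 < l1" and "l1 < 1"
  shows "(\<forall>c>0. (\<exists>!S. lyapunov_solution (shear_matrix l1 l2 c) (mat 1) S)
            \<and> (\<exists>V. unit_eigenvector_matrix (shear_matrix l1 l2 c) V)
            \<and> (\<exists>u. {w. minor_principal_direction (shear_covariance l1 l2 c) w} = {u, - u}))
    \<and> (\<forall>(V :: real \<Rightarrow> real^2^2) (u :: real \<Rightarrow> real^2).
         (\<forall>c>0. unit_eigenvector_matrix (shear_matrix l1 l2 c) (V c)
              \<and> minor_principal_direction (shear_covariance l1 l2 c) (u c))
         \<longrightarrow> (\<lambda>c. cond2 (V c)) \<in> \<Theta>[at_top](\<lambda>c. c)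
           \<and> (\<forall>j. tendsto_up_to_sign (\<lambda>c. column j (V c)) (axis 1 1) at_top)
           \<and> tendsto_up_to_sign u (axis 2 1) at_top
           \<and> ((\<lambda>c. nearest_mode_angle (u c) (V c)) \<longlongrightarrow> pi / 2) at_top
           \<and> (\<lambda>c. \<bar>cos (nearest_mode_angle (u c) (V c))\<bar>) \<in> O[at_top](\<lambda>c. inverse (cond2 (V c))))"
proof (intro conjI allI impI)
  have ne1: "l1\<^sup>2 \<noteq> 1" "l2\<^sup>2 \<noteq> 1" "l1 * l2 \<noteq> 1"
    and lt1: "l2\<^sup>2 < 1" "l1 * l2 < 1"
    using assms by (auto simp: power2_eq_1_iff power_less_one_iff) (smt (verit) mult_less_cancel_left2)+
  fix c :: real assume "c > 0"
  show "\<exists>!S. lyapunov_solution (shear_matrix l1 l2 c) (mat 1) S"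
    unfolding lyapunov_solution_shear_iff[OF ne1] by simp
  show "\<exists>V. unit_eigenvector_matrix (shear_matrix l1 l2 c) V"
    using assms \<open>c > 0\<close> by (intro ex_unit_eigenvector_matrix_shear)
  \<comment> \<open>Positivity of \<open>l2\<close> and \<open>c\<close> keeps the off-diagonal
    entry nonzero, so the minor eigenspace is a line.\<close>
  have "cov12 l1 l2 c \<noteq> 0"
    using assms lt1 \<open>c > 0\<close> by (simp add: cov12_def cov22_def)
  then show "\<exists>u. {w. minor_principal_direction (shear_covariance l1 l2 c) w} = {u, - u}"
    by (rule minor_principal_direction_sym2_unique[OF shear_covariance_eq[OF ne1]])
next
  fix V :: "real \<Rightarrow> real^2^2" and u :: "real \<Rightarrow> real^2"
  assume H: "\<forall>c>0. unit_eigenvector_matrix (shear_matrix l1 l2 c) (V c)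
    \<and> minor_principal_direction (shear_covariance l1 l2 c) (u c)"
  define d where "d = l1 - l2"
  define K where "K = 2 / (1 - l1 * l2)"
  have "d > 0" using assms by (simp add: d_def)
  have col: "norm (column j (V c)) = 1" "\<bar>column j (V c) $ 2\<bar> \<le> d / c" if "c > 0" for c j
    using H that assms unit_eigenvector_shear_bound[of "column j (V c)" l1 l2 c]
    by (auto simp: unit_eigenvector_matrix_def d_def)
  have u1: "norm (u c) = 1" "\<bar>u c $ 1\<bar> \<le> K / c" if "c \<ge> 2" for c
    using H that assms minor_principal_direction_shear_bound[of l2 l1 c "u c"]
    by (auto simp: minor_principal_direction_def K_def)
  have ge2: "\<forall>\<^sub>F c in at_top. (c::real) \<ge> 2" by (rule eventually_ge_at_top)

  show theta: "(\<lambda>c. cond2 (V c)) \<in> \<Theta>[at_top](\<lambda>c. c)"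
  proof (rule bigthetaI')
    \<comment> \<open>For \<open>c \<ge> d\<close> the root \<open>N\<close> lies between
      \<open>c\<close> and \<open>c + d \<le> 2 * c\<close>; the upper constant combines this 2 with
      the factor 16 of the determinant bound.\<close>
    show "1 / d > 0" "32 / d > 0" using \<open>d > 0\<close> by auto
    show "\<forall>\<^sub>F c in at_top. 1 / d * norm c \<le> norm (cond2 (V c)) \<and> norm (cond2 (V c)) \<le> 32 / d * norm c"
      using eventually_ge_at_top[of d]
    proof (rule eventually_mono)
      fix c assume "d \<le> c"
      then have "c > 0" using \<open>d > 0\<close> by simp
      define N where "N = sqrt (c\<^sup>2 + d\<^sup>2)"
      have "sqrt (c\<^sup>2) \<le> N" unfolding N_def by (intro real_sqrt_le_mono) simp
      then have "c \<le> N" using \<open>c > 0\<close> by simp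
      have "N \<le> c + d" unfolding N_def
        using \<open>c > 0\<close> \<open>d > 0\<close> by (intro sqrt_sum_squares_le_sum) auto
      have dV: "\<bar>det (V c)\<bar> = d / N"
        using det_unit_eigenvector_matrix_shear[of l1 l2 c "V c"] H \<open>c > 0\<close> assms
        by (auto simp: N_def d_def)
      then have "det (V c) \<noteq> 0" using \<open>d > 0\<close> \<open>c \<le> N\<close> \<open>c > 0\<close> by auto
      note b = cond2_unit_columns_bounds[OF col(1)[OF \<open>c > 0\<close>] this, unfolded dV]
      have "c / d \<le> N / d" using \<open>c \<le> N\<close> \<open>d > 0\<close> by (intro divide_right_mono) auto
      with b have lo: "c / d \<le> cond2 (V c)" by simp
      have "16 * N / d \<le> 32 * c / d"
        using \<open>N \<le> c + d\<close> \<open>d \<le> c\<close> \<open>d > 0\<close> by (intro divide_right_mono) auto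
      with b have hi: "cond2 (V c) \<le> 32 * c / d" by simp
      have "0 \<le> cond2 (V c)" using lo \<open>c > 0\<close> \<open>d > 0\<close> by (auto intro: order_trans[rotated])
      then show "1 / d * norm c \<le> norm (cond2 (V c)) \<and> norm (cond2 (V c)) \<le> 32 / d * norm c"
        using lo hi \<open>c > 0\<close> by simp
    qed
  qed

  show "tendsto_up_to_sign (\<lambda>c. column j (V c)) (axis 1 1) at_top" for j
    by (rule tendsto_up_to_sign_axis2[where j = 2 and K = d])
      (auto simp: UNIV_2 col intro!: eventually_mono[OF ge2])
  show "tendsto_up_to_sign u (axis 2 1) at_top"
    by (rule tendsto_up_to_sign_axis2[where j = 1 and K = K])
      (auto simp: UNIV_2 u1 intro!: eventually_mono[OF ge2])

  \<comment> \<open>The cosine is estimated first, since it is an inner product of unit vectors; the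
    angle is recovered by continuity of \<open>arccos\<close> at 0.\<close>
  define t where "t c = cos (nearest_mode_angle (u c) (V c))" for c
  have t_le: "\<forall>\<^sub>F c in at_top. \<bar>t c\<bar> \<le> (K + d) / c"
    using ge2
  proof (rule eventually_mono)
    fix c :: real assume "c \<ge> 2"
    obtain j where j: "nearest_mode_angle (u c) (V c) = line_angle (u c) (column j (V c))"
      by (rule nearest_mode_angle_obtain)
    have "\<bar>t c\<bar> = \<bar>u c \<bullet> column j (V c)\<bar>"
      using u1(1)[of c] col(1)[of c j] \<open>c \<ge> 2\<close> by (simp add: t_def j cos_line_angle)
    also have "\<dots> \<le> \<bar>u c $ 1\<bar> + \<bar>column j (V c) $ 2\<bar>"
      using u1(1)[of c] col(1)[of c j] \<open>c \<ge> 2\<close> by (intro abs_inner_unit2_le) auto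
    also have "\<dots> \<le> K / c + d / c"
      using u1(2)[of c] col(2)[of c j] \<open>c \<ge> 2\<close> by (intro add_mono) auto
    finally show "\<bar>t c\<bar> \<le> (K + d) / c" by (simp add: add_divide_distrib)
  qed

  have "((\<lambda>c. (K + d) / c) \<longlongrightarrow> 0) at_top"
    by (intro tendsto_divide_0[OF tendsto_const] filterlim_at_top_imp_at_infinity filterlim_ident)
  then have "(t \<longlongrightarrow> 0) at_top"
    by (rule Lim_null_comparison[rotated]) (use t_le in simp)
  then have "((\<lambda>c. arccos (t c)) \<longlongrightarrow> arccos 0) at_top"
    by (intro isCont_tendsto_compose[of 0 arccos] isCont_arccos) auto
  moreover have "arccos (t c) = nearest_mode_angle (u c) (V c)" for c
    unfolding t_def by (rule nearest_mode_angle_obtain[of "u c" "V c"]) (simp add: arccos_cos_line_angle)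
  ultimately show "((\<lambda>c. nearest_mode_angle (u c) (V c)) \<longlongrightarrow> pi / 2) at_top"
    by simp

  have "(\<lambda>c. \<bar>t c\<bar>) \<in> O[at_top](\<lambda>c. inverse c)"
    by (rule bigoI[where c = "K + d"])
      (use t_le eventually_gt_at_top[of "0::real"] in eventually_elim, simp add: divide_inverse)
  \<comment> \<open>The rate in \<open>c\<close> becomes a rate in the condition number, as the two
    are of the same order.\<close>
  also have "(\<lambda>c. inverse c) \<in> \<Theta>[at_top](\<lambda>c. inverse (cond2 (V c)))"
    using theta by (simp only: bigtheta_inverse bigtheta_sym)
  finally show "(\<lambda>c. \<bar>cos (nearest_mode_angle (u c) (V c))\<bar>) \<in> O[at_top](\<lambda>c. inverse (cond2 (V c)))"
    by (simp add: t_def)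
qed

end
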